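(* The following conditions are equivalent: (1) $\mathfrak b>\omega_1$; (2) the filter of neighborhoods of $O$ in $V(\omega)$ is an $A$-filter and has no countable base; (3) $V(\omega)$ is a nonmetrizable $\mathbb R^{\omega_1}$-factorizable space.
   Context: All topological spaces are assumed to be Tychonoff. A space $X$ is $\mathbb R^{\omega_1}$-factorizable if for every continuous function $f\colon X\to\mathbb R^{\omega_1}$ there exist a second-countable space $Y$ and continuous functions $h\colon X\to Y$ and $g\colon Y\to\mathbb R^{\omega_1}$ such that $f=g\circ h$. The Fréchet--Urysohn fan $V(\omega)$ is the image of the topological sum of countably many copies of the convergent sequence $\{\frac1n:n\in\mathbb N\}\cup\{0\}$ (with $\mathbb N$ the positive integers) under the quotient map contracting the set of limit points of all these sequences to a single point $O$. For $f,g\in\omega^\omega$, $f\le^*g$ means that $f(n)\le g(n)$ for all but finitely many $n\in\omega$; $\mathfrak b$ is the minimum cardinality of a subset of $\omega^\omega$ that is unbounded with respect to $\le^*$. A filter $\mathscr F$ on a set is an $A$-filter if, given any $F_\alpha\in\mathscr F$, $\alpha<\omega_1$, there exist $G_n\in\mathscr F$, $n<\omega$, such that each $F_\alpha$ contains $G_{n_\alpha}$ for some $n_\alpha<\omega$. A base of $\mathscr F$ is a subfamily $\mathscr B\subset\mathscr F$ such that every element of $\mathscr F$ contains an element of $\mathscr B$. *)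

theory Defs
  imports "HOL-Analysis.Analysis"
begin

unbundle cardinal_syntax

section \<open>Cardinals\<close>

definition omega1 :: "nat set rel" where
  "omega1 = cardSuc natLeq"

definition le_star :: "(nat \<Rightarrow> nat) \<Rightarrow> (nat \<Rightarrow> nat) \<Rightarrow> bool" (infix "\<le>\<^sup>*" 50) where
  "f \<le>\<^sup>* g \<longleftrightarrow> finite {n. \<not> f n \<le> g n}"

definition unbounded_family :: "(nat \<Rightarrow> nat) set \<Rightarrow> bool" where
  "unbounded_family B \<longleftrightarrow> \<not> (\<exists>g. \<forall>f\<in>B. f \<le>\<^sup>* g)"

definition bounding_number :: "(nat \<Rightarrow> nat) rel" where
  "bounding_number =
     |SOME B. unbounded_family B \<and> (\<forall>C. unbounded_family C \<longrightarrow> |B| \<le>o |C| )|"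

lemma unbounded_family_UNIV: "unbounded_family UNIV"
proof -
  have "\<not> (\<lambda>n. Suc (g n)) \<le>\<^sup>* g" for g
    by (simp add: le_star_def)
  then show ?thesis
    by (auto simp: unbounded_family_def)
qed

text \<open>The choice in the definition of the bounding number is from a nonempty set.\<close>

lemma bounding_number_minimum:
  obtains B where "unbounded_family B" "bounding_number = |B|"
    "\<And>C. unbounded_family C \<Longrightarrow> bounding_number \<le>o |C|"
proof -
  let ?R = "card_of ` {B. unbounded_family B}"
  have "\<exists>r\<in>?R. \<forall>r'\<in>?R. r \<le>o r'"
    by (rule exists_minim_Card_order) (use unbounded_family_UNIV card_of_Card_order in auto)
  then have "\<exists>B. unbounded_family B \<and> (\<forall>C. unbounded_family C \<longrightarrow> |B| \<le>o |C| )"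
    by auto
  from someI_ex[OF this] show ?thesis
    by (intro that) (auto simp: bounding_number_def)
qed

section \<open>Factorizability\<close>

definition tychonoff_space :: "'a topology \<Rightarrow> bool" where
  "tychonoff_space X \<longleftrightarrow> completely_regular_space X \<and> Hausdorff_space X"

definition R_omega1 :: "(nat set \<Rightarrow> real) topology" where
  "R_omega1 = product_topology (\<lambda>_. euclideanreal) (Field omega1)"

text \<open>
  HOL cannot quantify existentially over the type of points of the space \<open>Y\<close>. The type
  \<open>nat \<Rightarrow> real\<close> loses no generality, because a second-countable \<open>T\<^sub>0\<close> space has at most
  continuum many points; see \<open>R_omega1_factorizableI\<close> below, where the points of \<open>Y\<close>
  have an arbitrary type.
\<close>

definition R_omega1_factorizable :: "'a topology \<Rightarrow> bool" where
  "R_omega1_factorizable X \<longleftrightarrow>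
     (\<forall>f. continuous_map X R_omega1 f \<longrightarrow>
        (\<exists>(Y :: (nat \<Rightarrow> real) topology) h g.
           tychonoff_space Y \<and> second_countable Y \<and>
           continuous_map X Y h \<and> continuous_map Y R_omega1 g \<and>
           (\<forall>x\<in>topspace X. f x = (g \<circ> h) x)))"

lemma second_countable_homeomorphic_copy:
  fixes Y :: "'b topology"
  assumes "second_countable Y" "Hausdorff_space Y"
  obtains Z :: "(nat \<Rightarrow> real) topology" and p q where "homeomorphic_maps Y Z p q"
proof -
  obtain \<B> where \<B>: "countable \<B>" "\<And>V. V \<in> \<B> \<Longrightarrow> openin Y V"
    "\<And>U x. openin Y U \<Longrightarrow> x \<in> U \<Longrightarrow> \<exists>V\<in>\<B>. x \<in> V \<and> V \<subseteq> U"
    using assms(1) unfolding second_countable_def by (auto simp: all_conj_distrib)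
  define p :: "'b \<Rightarrow> nat \<Rightarrow> real" where
    "p = (\<lambda>y n. if n \<in> to_nat_on \<B> ` {V\<in>\<B>. y \<in> V} then 1 else 0)"
  have inj: "inj_on p (topspace Y)"
  proof (rule inj_onI, rule ccontr)
    fix x y assume xy: "x \<in> topspace Y" "y \<in> topspace Y" "p x = p y" "x \<noteq> y"
    then obtain U V where "openin Y U" "x \<in> U" "y \<in> V" "disjnt U V"
      using assms(2) unfolding Hausdorff_space_def by meson
    then obtain B where B: "B \<in> \<B>" "x \<in> B" "y \<notin> B"
      using \<B>(3) by (metis disjnt_iff subsetD)
    have "p x (to_nat_on \<B> B) = 1"
      using B by (auto simp: p_def)
    moreover have "p y (to_nat_on \<B> B) = 0"
      using B \<B>(1) by (auto simp: p_def dest: inj_onD[OF inj_on_to_nat_on])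
    ultimately show False using xy by simp
  qed
  define q where "q = inv_into (topspace Y) p"
  have qp: "q (p y) = y" if "y \<in> topspace Y" for y
    using inj that by (simp add: q_def)
  define Z where "Z = pullback_topology (p ` topspace Y) q Y"
  have top: "topspace Z = p ` topspace Y"
    using qp by (auto simp: Z_def topspace_pullback_topology)
  have "continuous_map Z Y (id \<circ> q)"
    unfolding Z_def by (rule continuous_map_pullback) simp
  moreover have "continuous_map Y Z p"
    unfolding Z_def
  proof (rule continuous_map_pullback')
    show "continuous_map Y Y (q \<circ> p)"
      by (rule continuous_map_eq[of _ _ id]) (auto simp: qp)
  qed auto
  ultimately have "homeomorphic_maps Y Z p q"
    by (auto simp: homeomorphic_maps_def qp top)
  then show ?thesis by (rule that)
qed

lemma R_omega1_factorizableI: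
  fixes X :: "'a topology"
  assumes "\<And>f. continuous_map X R_omega1 f \<Longrightarrow>
     \<exists>(Y :: 'b topology) h g.
       tychonoff_space Y \<and> second_countable Y \<and>
       continuous_map X Y h \<and> continuous_map Y R_omega1 g \<and>
       (\<forall>x\<in>topspace X. f x = (g \<circ> h) x)"
  shows "R_omega1_factorizable X"
  unfolding R_omega1_factorizable_def
proof (intro allI impI)
  fix f assume "continuous_map X R_omega1 f"
  from assms[OF this] obtain Y :: "'b topology" and h g where
    Y: "tychonoff_space Y" "second_countable Y" and
    h: "continuous_map X Y h" and g: "continuous_map Y R_omega1 g" and
    eq: "\<And>x. x \<in> topspace X \<Longrightarrow> f x = g (h x)"
    by auto
  obtain Z :: "(nat \<Rightarrow> real) topology" and p q where pq: "homeomorphic_maps Y Z p q"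
    using second_countable_homeomorphic_copy Y unfolding tychonoff_space_def by metis
  then have YZ: "Y homeomorphic_space Z"
    by (auto simp: homeomorphic_space_def)
  have "tychonoff_space Z" "second_countable Z"
    using Y homeomorphic_space_second_countability[OF YZ] homeomorphic_Hausdorff_space[OF YZ]
      homeomorphic_completely_regular_space[OF YZ]
    by (auto simp: tychonoff_space_def)
  moreover have "continuous_map X Z (p \<circ> h)" "continuous_map Z R_omega1 (g \<circ> q)"
    using pq h g by (auto simp: homeomorphic_maps_def intro: continuous_map_compose)
  moreover have "\<forall>x\<in>topspace X. f x = ((g \<circ> q) \<circ> (p \<circ> h)) x"
    using pq h eq by (auto simp: homeomorphic_maps_def continuous_map_def Pi_iff)
  ultimately show "\<exists>(Y :: (nat \<Rightarrow> real) topology) h g.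
       tychonoff_space Y \<and> second_countable Y \<and>
       continuous_map X Y h \<and> continuous_map Y R_omega1 g \<and>
       (\<forall>x\<in>topspace X. f x = (g \<circ> h) x)"
    by (intro exI[of _ Z] exI[of _ "p \<circ> h"] exI[of _ "g \<circ> q"] conjI)
qed

section \<open>The Frechet--Urysohn fan\<close>

definition quotient_topology :: "'a topology \<Rightarrow> ('a \<Rightarrow> 'b) \<Rightarrow> 'b topology" where
  "quotient_topology X q =
     topology (\<lambda>U. U \<subseteq> q ` topspace X \<and> openin X {x \<in> topspace X. q x \<in> U})"

lemma openin_quotient_topology:
  "openin (quotient_topology X q) U \<longleftrightarrow>
     U \<subseteq> q ` topspace X \<and> openin X {x \<in> topspace X. q x \<in> U}"
proof -
  have "istopology (\<lambda>U. U \<subseteq> q ` topspace X \<and> openin X {x \<in> topspace X. q x \<in> U})"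
    unfolding istopology_def
  proof (intro conjI allI impI; (elim conjE)?)
    fix S T
    assume "openin X {x \<in> topspace X. q x \<in> S}" "openin X {x \<in> topspace X. q x \<in> T}"
    from openin_Int[OF this] show "openin X {x \<in> topspace X. q x \<in> S \<inter> T}"
      by (rule back_subst[of "openin X"]) auto
  next
    fix \<K> assume *: "\<forall>K\<in>\<K>. K \<subseteq> q ` topspace X \<and> openin X {x \<in> topspace X. q x \<in> K}"
    have "openin X (\<Union>K\<in>\<K>. {x \<in> topspace X. q x \<in> K})"
      using * by auto
    then show "openin X {x \<in> topspace X. q x \<in> \<Union>\<K>}"
      by (rule back_subst[of "openin X"]) auto
  qed auto
  then show ?thesis
    by (simp add: quotient_topology_def)
qed

lemma topspace_quotient_topology: "topspace (quotient_topology X q) = q ` topspace X"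
proof
  show "topspace (quotient_topology X q) \<subseteq> q ` topspace X"
    using openin_quotient_topology openin_topspace by metis
  have "{x \<in> topspace X. q x \<in> q ` topspace X} = topspace X"
    by auto
  then show "q ` topspace X \<subseteq> topspace (quotient_topology X q)"
    by (intro openin_subset) (simp add: openin_quotient_topology)
qed

lemma quotient_map_quotient_topology: "quotient_map X (quotient_topology X q) q"
  by (auto simp: quotient_map_def topspace_quotient_topology openin_quotient_topology)

definition convergent_sequence :: "real topology" where
  "convergent_sequence = subtopology euclideanreal ({1 / real n |n. n \<ge> 1} \<union> {0})"

text \<open>The value \<open>None\<close> is the point \<open>O\<close> to which all limit points \<open>(k, 0)\<close> are contracted.\<close>

definition contract_limits :: "nat \<times> real \<Rightarrow> (nat \<times> real) option" where
  "contract_limits = (\<lambda>(k, x). if x = 0 then None else Some (k, x))"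

definition fan :: "(nat \<times> real) option topology" where
  "fan = quotient_topology (sum_topology (\<lambda>_. convergent_sequence) UNIV) contract_limits"

abbreviation fan_point :: "(nat \<times> real) option" where
  "fan_point \<equiv> None"

section \<open>Filters\<close>

text \<open>
  A set \<open>A\<close> belongs to the filter \<open>F\<close> iff \<open>eventually (\<lambda>x. x \<in> A) F\<close>. In particular,
  the members of \<open>nhdsin X a\<close> are the sets that include an open neighbourhood of \<open>a\<close> in \<open>X\<close>.
\<close>

definition filter_sets :: "'a filter \<Rightarrow> 'a set set" where
  "filter_sets F = {A. eventually (\<lambda>x. x \<in> A) F}"

lemma filter_sets_nhdsin:
  assumes "a \<in> topspace X"
  shows "filter_sets (nhdsin X a) = {A. \<exists>U. openin X U \<and> a \<in> U \<and> U \<subseteq> A}"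
  using assms by (auto simp: filter_sets_def eventually_nhdsin)

definition A_filter :: "'a filter \<Rightarrow> bool" where
  "A_filter F \<longleftrightarrow>
     (\<forall>A :: nat set \<Rightarrow> 'a set. (\<forall>\<alpha>\<in>Field omega1. A \<alpha> \<in> filter_sets F) \<longrightarrow>
        (\<exists>G :: nat \<Rightarrow> 'a set. (\<forall>n. G n \<in> filter_sets F) \<and>
           (\<forall>\<alpha>\<in>Field omega1. \<exists>n. G n \<subseteq> A \<alpha>)))"

definition is_filter_base :: "'a set set \<Rightarrow> 'a filter \<Rightarrow> bool" where
  "is_filter_base \<B> F \<longleftrightarrow>
     \<B> \<subseteq> filter_sets F \<and> (\<forall>A\<in>filter_sets F. \<exists>B\<in>\<B>. B \<subseteq> A)"

end

theory Submission
  imports Defs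
begin

text \<open>
  The basic neighbourhoods of \<open>O\<close> in the fan are the sets \<open>fan_nhd g\<close>, \<open>g \<in> \<omega>\<^sup>\<omega>\<close>, which remove the
  first \<open>g k\<close> points from the \<open>k\<close>-th sequence, and \<open>fan_nhd f \<subseteq> fan_nhd g\<close> holds iff \<open>g \<le> f\<close>
  everywhere. Everything about the neighbourhood filter thus becomes a statement about functions.

  A bound \<open>g\<close> of a family in the sense of \<open>\<le>\<^sup>*\<close> bounds each member everywhere after a constant has
  been added to it. Hence the countably many sets \<open>fan_nhd (\<lambda>k. g k + n)\<close> refine all the
  \<open>fan_nhd f\<close> with \<open>f\<close> in the family. Conversely, countably many functions always have a common
  bound, so a family of neighbourhoods that is refined by countably many neighbourhoods comes from
  a bounded family of functions. So the filter is an \<open>A\<close>-filter iff all families of cardinality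
  \<open>\<omega>\<^sub>1\<close> are bounded, which is the inequality \<open>\<omega>\<^sub>1 < \<bb>\<close> (\<open>A_filter_fan_iff\<close>).

  The other equivalence uses little about the fan. In a completely regular space, \<open>\<omega>\<^sub>1\<close> many
  neighbourhoods of a point are described by \<open>\<omega>\<^sub>1\<close> many real functions, that is, by one map to
  \<open>\<real>\<^bsup>\<omega>\<^sub>1\<^esup>\<close>; pulling back a countable base from a second-countable factor gives the sets \<open>G\<^sub>n\<close>
  (\<open>R_omega1_factorizable_imp_A_filter\<close>). In the converse direction, the continuity of a map to
  \<open>\<real>\<^bsup>\<omega>\<^sub>1\<^esup>\<close> at \<open>O\<close> is witnessed by \<open>\<omega>\<^sub>1\<close> many neighbourhoods. If countably many neighbourhoods refine
  all of these, then these countably many, together with the complements of the other points,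
  generate a coarser second-countable topology on the same countable set, in which all points but
  \<open>O\<close> are still isolated and the map is still continuous (\<open>A_filter_imp_R_omega1_factorizable\<close>).

  Finally, a diagonal argument shows that the filter has no countable base. So the fan is not first
  countable, let alone metrizable.
\<close>

section \<open>The cardinal \<open>\<omega>\<^sub>1\<close> and families of functions\<close>

lemma Card_order_omega1: "Card_order omega1"
  unfolding omega1_def by (rule cardSuc_Card_order[OF natLeq_Card_order])

lemma infinite_Field_omega1: "\<not> finite (Field omega1)"
  unfolding omega1_def
  by (simp add: cardSuc_finite[OF natLeq_Card_order] Field_natLeq)

lemma card_of_Field_omega1: "|Field omega1| =o omega1"
  by (rule card_of_Field_ordIso[OF Card_order_omega1])

lemma card_of_Field_omega1_times_nat: "|Field omega1 \<times> (UNIV :: nat set)| \<le>o omega1"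
proof (rule card_of_Times_ordLeq_infinite_Field[OF infinite_Field_omega1 _ _ Card_order_omega1])
  show "|Field omega1| \<le>o omega1"
    by (rule ordIso_imp_ordLeq[OF card_of_Field_omega1])
  show "|UNIV :: nat set| \<le>o omega1"
    by (rule ordLeq_ordIso_trans[OF iffD1[OF infinite_iff_card_of_nat infinite_Field_omega1]
        card_of_Field_omega1])
qed

text \<open>
  Enumerating \<open>I\<close> by \<open>Field omega1\<close> makes the \<open>A\<close>-filter property available for families with other
  index sets, such as \<open>\<omega>\<^sub>1 \<times> \<omega>\<close> and sets of functions.
\<close>

lemma A_filter_countable_refinement:
  fixes A :: "'i \<Rightarrow> 'a set"
  assumes "A_filter F" and I: "|I| \<le>o omega1" and A: "\<And>i. i \<in> I \<Longrightarrow> A i \<in> filter_sets F"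
  shows "\<exists>G :: nat \<Rightarrow> 'a set. (\<forall>n. G n \<in> filter_sets F) \<and> (\<forall>i\<in>I. \<exists>n. G n \<subseteq> A i)"
proof (cases "I = {}")
  case True
  show ?thesis
    by (rule exI[of _ "\<lambda>_. UNIV"]) (auto simp: True filter_sets_def)
next
  case False
  have "|I| \<le>o |Field omega1|"
    by (rule ordLeq_ordIso_trans[OF I ordIso_symmetric[OF card_of_Field_omega1]])
  then obtain e where e: "e ` Field omega1 = I"
    unfolding card_of_ordLeq2[OF False, symmetric] by (elim exE)
  then have "\<forall>\<alpha>\<in>Field omega1. A (e \<alpha>) \<in> filter_sets F"
    using A by blast
  from \<open>A_filter F\<close>[unfolded A_filter_def, THEN spec, THEN mp, OF this]
  have "\<exists>G :: nat \<Rightarrow> 'a set. (\<forall>n. G n \<in> filter_sets F) \<and>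
      (\<forall>\<alpha>\<in>Field omega1. \<exists>n. G n \<subseteq> A (e \<alpha>))" .
  then show ?thesis
    unfolding e[symmetric] by (simp only: ball_simps)
qed

lemma le_star_trans:
  assumes "f \<le>\<^sup>* g" "g \<le>\<^sup>* h"
  shows "f \<le>\<^sup>* h"
proof -
  have "{n. \<not> f n \<le> h n} \<subseteq> {n. \<not> f n \<le> g n} \<union> {n. \<not> g n \<le> h n}"
    by auto
  then show ?thesis
    using assms unfolding le_star_def by (meson finite_UnI finite_subset)
qed

lemma le_star_if_le: "(\<And>n. f n \<le> g n) \<Longrightarrow> f \<le>\<^sup>* g"
  by (simp add: le_star_def)

lemma countable_family_bounded:
  fixes f :: "nat \<Rightarrow> nat \<Rightarrow> nat"
  obtains g where "\<And>n. f n \<le>\<^sup>* g"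
proof
  fix n
  let ?g = "\<lambda>k. \<Sum>i\<le>k. f i k"
  have "f n k \<le> ?g k" if "n \<le> k" for k
    using that by (intro member_le_sum) auto
  then have "{k. \<not> f n k \<le> ?g k} \<subseteq> {..<n}"
    by (auto simp: not_le[symmetric])
  then show "f n \<le>\<^sup>* ?g"
    unfolding le_star_def by (rule finite_subset) simp
qed

lemma le_star_imp_le_add_const:
  assumes "f \<le>\<^sup>* g"
  obtains n where "\<And>k. f k \<le> g k + n"
proof
  fix k
  let ?E = "{k. \<not> f k \<le> g k}"
  have "finite ?E"
    using assms by (simp add: le_star_def)
  then have "f k \<le> (\<Sum>i\<in>?E. f i)" if "k \<in> ?E"
    using that by (intro member_le_sum) auto
  then show "f k \<le> g k + (\<Sum>i\<in>?E. f i)"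
    by (cases "k \<in> ?E") auto
qed

lemma omega1_less_bounding_number_iff:
  "omega1 <o bounding_number \<longleftrightarrow> (\<forall>B. |B| \<le>o omega1 \<longrightarrow> \<not> unbounded_family B)"
proof -
  obtain B where B: "unbounded_family B" "bounding_number = |B|"
      "\<And>C. unbounded_family C \<Longrightarrow> bounding_number \<le>o |C|"
    using bounding_number_minimum by blast
  have "\<not> omega1 <o bounding_number \<longleftrightarrow> |B| \<le>o omega1"
    unfolding B(2) using Card_order_omega1
    by (intro not_ordLess_iff_ordLeq) (auto simp: card_order_on_well_order_on card_of_Well_order)
  also have "\<dots> \<longleftrightarrow> (\<exists>C. |C| \<le>o omega1 \<and> unbounded_family C)"
    using B ordLeq_transitive by metis
  finally show ?thesis by blast
qed

section \<open>Spaces with at most one nonisolated point\<close>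

text \<open>
  Such a space has a base of clopen sets: an open set that contains \<open>p\<close> is clopen because its
  complement consists of isolated points, and the singletons of the other points are clopen by \<open>T\<^sub>1\<close>.
\<close>

lemma tychonoff_if_one_nonisolated_point:
  assumes isolated: "\<And>x. x \<in> topspace X \<Longrightarrow> x \<noteq> p \<Longrightarrow> openin X {x}"
    and "t1_space X"
  shows "tychonoff_space X"
proof -
  have open_if: "openin X U" if "U \<subseteq> topspace X" "p \<notin> U" for U
    using that isolated by (subst openin_subopen) blast
  have closed: "closedin X {x}" if "x \<in> topspace X" for x
    using \<open>t1_space X\<close> that by (simp add: t1_space_closedin_singleton)
  have "\<exists>V. openin X V \<and> closedin X V \<and> x \<in> V \<and> V \<subseteq> U" if "openin X U" "x \<in> U" for U x
  proof (cases "p \<in> U")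
    case True
    then have "closedin X U"
      using openin_subset[OF that(1)] by (auto simp: closedin_def intro: open_if)
    then show ?thesis using that by blast
  next
    case False
    then have "openin X {x}" "closedin X {x}"
      using that openin_subset[OF that(1)] isolated closed by blast+
    then show ?thesis using that by blast
  qed
  then have "X dim_le 0"
    unfolding dimension_le_0_neighbourhood_base_of_clopen
    by (subst open_neighbourhood_base_of) blast+
  then have "completely_regular_space X"
    by (rule zero_dimensional_imp_completely_regular_space)
  moreover have "Hausdorff_space X"
    by (metis \<open>completely_regular_space X\<close> \<open>t1_space X\<close> completely_regular_imp_regular_space
        regular_t1_imp_Hausdorff_space)
  ultimately show ?thesis
    by (simp add: tychonoff_space_def)
qed

text \<open>
  Applied to a decreasing sequence of neighbourhoods of the only nonisolated point \<open>p\<close> of a countable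
  space, this replaces the neighbourhood filter of \<open>p\<close> by a countably generated one. The sets \<open>H n\<close> and
  the singletons of the points other than \<open>p\<close> form a countable base.
\<close>

lemma second_countable_coarsening:
  fixes H :: "nat \<Rightarrow> 'a set"
  assumes V: "countable V" and p: "p \<in> V"
    and H: "decseq H" "\<And>n. p \<in> H n" "\<And>n. H n \<subseteq> V"
    and sep: "\<And>x. x \<in> V \<Longrightarrow> x \<noteq> p \<Longrightarrow> \<exists>n. x \<notin> H n"
  shows "\<exists>Y. topspace Y = V \<and> (\<forall>U. openin Y U \<longleftrightarrow> U \<subseteq> V \<and> (p \<in> U \<longrightarrow> (\<exists>n. H n \<subseteq> U))) \<and>
    second_countable Y \<and> tychonoff_space Y"
proof -
  define P where "P U \<longleftrightarrow> U \<subseteq> V \<and> (p \<in> U \<longrightarrow> (\<exists>n. H n \<subseteq> U))" for U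
  have "istopology P"
    unfolding istopology_def
  proof (intro conjI allI impI)
    fix S T assume S: "P S" and T: "P T"
    show "P (S \<inter> T)"
      unfolding P_def
    proof (intro conjI impI)
      show "S \<inter> T \<subseteq> V" using S by (auto simp: P_def)
      assume "p \<in> S \<inter> T"
      then obtain m n where "H m \<subseteq> S" "H n \<subseteq> T"
        using S T by (auto simp: P_def)
      then have "H (max m n) \<subseteq> S \<inter> T"
        using decseqD[OF H(1), of m "max m n"] decseqD[OF H(1), of n "max m n"] by auto
      then show "\<exists>n. H n \<subseteq> S \<inter> T" ..
    qed
  next
    fix \<K> assume "\<forall>K\<in>\<K>. P K"
    then show "P (\<Union>\<K>)"
      unfolding P_def by (meson Sup_least Union_iff Union_upper order_trans)
  qed
  then have openin: "openin (topology P) U \<longleftrightarrow> P U" for U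
    by simp
  have "P V" using H(3) by (auto simp: P_def)
  then have top: "topspace (topology P) = V"
    by (metis openin P_def openin_subset openin_topspace subset_antisym)
  have isolated: "openin (topology P) {x}" if "x \<in> V" "x \<noteq> p" for x
    using that by (auto simp: openin P_def)
  have openH: "openin (topology P) (H n)" for n
    using H(3) by (auto simp: openin P_def)
  have "t1_space (topology P)"
    unfolding t1_space_def top
  proof (intro ballI impI)
    fix x y assume xy: "x \<in> V" "y \<in> V" "x \<noteq> y"
    show "\<exists>U. openin (topology P) U \<and> x \<in> U \<and> y \<notin> U"
    proof (cases "x = p")
      case True
      then show ?thesis using sep[of y] xy openH H(2) by blast
    next
      case False
      then show ?thesis using xy isolated by blast
    qed
  qed
  then have "tychonoff_space (topology P)"
    using isolated by (intro tychonoff_if_one_nonisolated_point[where p = p]) (auto simp: top)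
  moreover have "second_countable (topology P)"
    unfolding second_countable_def
  proof (intro exI conjI)
    let ?B = "range H \<union> (\<lambda>x. {x}) ` (V - {p})"
    show "countable ?B" using V by auto
    show "\<forall>U\<in>?B. openin (topology P) U" using openH isolated by auto
    show "\<forall>U x. openin (topology P) U \<and> x \<in> U \<longrightarrow> (\<exists>W\<in>?B. x \<in> W \<and> W \<subseteq> U)"
    proof (intro allI impI, elim conjE)
      fix U x assume U: "openin (topology P) U" "x \<in> U"
      show "\<exists>W\<in>?B. x \<in> W \<and> W \<subseteq> U"
      proof (cases "x = p")
        case True
        then show ?thesis using U H(2) by (auto simp: openin P_def)
      next
        case False
        then have "{x} \<in> ?B" using U by (auto simp: openin P_def)
        then show ?thesis using U by blast
      qed
    qed
  qed
  moreover have "\<forall>U. openin (topology P) U \<longleftrightarrow> U \<subseteq> V \<and> (p \<in> U \<longrightarrow> (\<exists>n. H n \<subseteq> U))"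
    by (simp add: openin P_def)
  ultimately show ?thesis
    using top by (intro exI[of _ "topology P"] conjI)
qed

section \<open>Factorizability and \<open>A\<close>-filters of neighbourhoods\<close>

text \<open>
  Complete regularity provides a map \<open>f\<close> to \<open>\<real>\<^bsup>\<omega>\<^sub>1\<^esup>\<close> whose \<open>\<alpha>\<close>-th coordinate is less than \<open>1\<close> only on
  the \<open>\<alpha>\<close>-th given neighbourhood. If \<open>f\<close> factors through \<open>h : X \<rightarrow> Y\<close>, then preimages under \<open>h\<close> of
  a countable base at \<open>h a\<close> refine all these neighbourhoods.
\<close>

theorem R_omega1_factorizable_imp_A_filter:
  assumes X: "R_omega1_factorizable X" "completely_regular_space X" and a: "a \<in> topspace X"
  shows "A_filter (nhdsin X a)"
  unfolding A_filter_def
proof (intro allI impI)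
  fix A :: "nat set \<Rightarrow> 'a set"
  assume A: "\<forall>\<alpha>\<in>Field omega1. A \<alpha> \<in> filter_sets (nhdsin X a)"
  have "\<exists>\<phi>. continuous_map X euclideanreal \<phi> \<and> \<phi> a = 0 \<and>
          (\<forall>x\<in>topspace X. \<phi> x < 1 \<longrightarrow> x \<in> A \<alpha>)" if \<alpha>: "\<alpha> \<in> Field omega1" for \<alpha>
  proof -
    obtain U where U: "openin X U" "a \<in> U" "U \<subseteq> A \<alpha>"
      using bspec[OF A \<alpha>] unfolding filter_sets_nhdsin[OF a] by blast
    have closed: "closedin X (topspace X - U) \<and> a \<in> topspace X - (topspace X - U)"
      using a U by auto
    obtain \<phi> :: "'a \<Rightarrow> real" where \<phi>: "continuous_map X (top_of_set {0..1}) \<phi>" "\<phi> a = 0"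
        "\<phi> ` (topspace X - U) \<subseteq> {1}"
      using X(2)[unfolded completely_regular_space_def, THEN spec, THEN spec, THEN mp, OF closed]
      by blast
    have "x \<in> A \<alpha>" if "x \<in> topspace X" "\<phi> x < 1" for x
      using that \<phi>(3) U(3) by force
    then show ?thesis
      using continuous_map_into_fulltopology[OF \<phi>(1)] \<phi>(2) by (intro exI[of _ \<phi>]) blast
  qed
  then obtain \<phi> where \<phi>: "\<And>\<alpha>. \<alpha> \<in> Field omega1 \<Longrightarrow> continuous_map X euclideanreal (\<phi> \<alpha>)"
      "\<And>\<alpha>. \<alpha> \<in> Field omega1 \<Longrightarrow> \<phi> \<alpha> a = 0"
      "\<And>\<alpha> x. \<alpha> \<in> Field omega1 \<Longrightarrow> x \<in> topspace X \<Longrightarrow> \<phi> \<alpha> x < 1 \<Longrightarrow> x \<in> A \<alpha>"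
    by metis
  define f where "f x = restrict (\<lambda>\<alpha>. \<phi> \<alpha> x) (Field omega1)" for x
  have "continuous_map X R_omega1 f"
    unfolding R_omega1_def continuous_map_componentwise f_def using \<phi>(1) by auto
  from X(1)[unfolded R_omega1_factorizable_def, rule_format, OF this]
  obtain Y :: "(nat \<Rightarrow> real) topology" and h g where
    Y: "second_countable Y" and h: "continuous_map X Y h" and g: "continuous_map Y R_omega1 g"
    and f: "\<And>x. x \<in> topspace X \<Longrightarrow> f x = g (h x)"
    by auto
  have ha: "h a \<in> topspace Y"
    using h a by (auto simp: continuous_map_def)
  obtain \<B> where \<B>: "countable \<B>" "\<And>V. V \<in> \<B> \<Longrightarrow> openin Y V"
      "\<And>U x. openin Y U \<Longrightarrow> x \<in> U \<Longrightarrow> \<exists>V\<in>\<B>. x \<in> V \<and> V \<subseteq> U"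
    using Y unfolding second_countable_def by (auto simp: all_conj_distrib)
  let ?\<G> = "(\<lambda>V. {x \<in> topspace X. h x \<in> V}) ` {V\<in>\<B>. h a \<in> V}"
  have "?\<G> \<noteq> {}" using \<B>(3)[OF openin_topspace ha] by blast
  moreover have "countable ?\<G>" using \<B>(1) by simp
  ultimately have "range (from_nat_into ?\<G>) = ?\<G>"
    by (rule range_from_nat_into)
  then obtain G :: "nat \<Rightarrow> 'a set" where G: "range G = ?\<G>" ..
  have "G n \<in> filter_sets (nhdsin X a)" for n
  proof -
    have "G n \<in> ?\<G>" using G by blast
    then obtain V where V: "V \<in> \<B>" "h a \<in> V" "G n = {x \<in> topspace X. h x \<in> V}" by blast
    then have "openin X (G n)" using openin_continuous_map_preimage[OF h] \<B>(2) by simp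
    then show ?thesis
      using a V(2,3) unfolding filter_sets_nhdsin[OF a] by blast
  qed
  moreover have "\<exists>n. G n \<subseteq> A \<alpha>" if \<alpha>: "\<alpha> \<in> Field omega1" for \<alpha>
  proof -
    have "continuous_map Y euclideanreal (\<lambda>y. g y \<alpha>)"
      using g \<alpha> by (simp add: R_omega1_def continuous_map_componentwise)
    from openin_continuous_map_preimage[OF this, of "{..<1}"]
    have "openin Y {y \<in> topspace Y. g y \<alpha> < 1}"
      by simp
    moreover have "g (h a) \<alpha> = 0"
      using f[OF a] \<alpha> \<phi>(2) by (simp add: f_def flip: f[OF a])
    then have "h a \<in> {y \<in> topspace Y. g y \<alpha> < 1}"
      using ha by simp
    ultimately obtain V where V: "V \<in> \<B>" "h a \<in> V" "V \<subseteq> {y \<in> topspace Y. g y \<alpha> < 1}"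
      using \<B>(3) by meson
    have "{x \<in> topspace X. h x \<in> V} \<subseteq> A \<alpha>"
    proof clarify
      fix x assume x: "x \<in> topspace X" "h x \<in> V"
      then have "f x \<alpha> < 1" using V(3) f by auto
      then show "x \<in> A \<alpha>" using \<phi>(3) \<alpha> x by (simp add: f_def)
    qed
    moreover have "{x \<in> topspace X. h x \<in> V} \<in> range G"
      unfolding G using V by blast
    then obtain n where "{x \<in> topspace X. h x \<in> V} = G n" by (rule rangeE)
    ultimately have "G n \<subseteq> A \<alpha>" by simp
    then show ?thesis ..
  qed
  ultimately show "\<exists>G :: nat \<Rightarrow> 'a set. (\<forall>n. G n \<in> filter_sets (nhdsin X a)) \<and>
      (\<forall>\<alpha>\<in>Field omega1. \<exists>n. G n \<subseteq> A \<alpha>)"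
    by (intro exI[of _ G]) blast
qed

text \<open>
  The middle space is \<open>X\<close> itself with a coarser topology, and \<open>h\<close> is the identity. The topology has
  to be fine enough for all coordinates of \<open>f\<close> to be continuous, and for \<open>p\<close> to be separated from the
  other points.
\<close>

theorem A_filter_imp_R_omega1_factorizable:
  fixes X :: "'a topology"
  assumes F: "A_filter (nhdsin X p)" and p: "p \<in> topspace X" and count: "countable (topspace X)"
    and isolated: "\<And>x. x \<in> topspace X \<Longrightarrow> x \<noteq> p \<Longrightarrow> openin X {x}" and t1: "t1_space X"
  shows "R_omega1_factorizable X"
proof (rule R_omega1_factorizableI)
  fix f assume f: "continuous_map X R_omega1 f"
  let ?F = "nhdsin X p" and ?V = "topspace X"
  have f_coord: "continuous_map X euclideanreal (\<lambda>x. f x \<alpha>)" if "\<alpha> \<in> Field omega1" for \<alpha>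
    using f that by (simp add: R_omega1_def continuous_map_componentwise)
  define A where "A = (\<lambda>(\<alpha>, m :: nat). {x \<in> ?V. dist (f p \<alpha>) (f x \<alpha>) < inverse (Suc m)})"
  have A: "A i \<in> filter_sets ?F" if "i \<in> Field omega1 \<times> UNIV" for i
  proof -
    obtain \<alpha> m where i: "i = (\<alpha>, m)" "\<alpha> \<in> Field omega1" using \<open>i \<in> _\<close> by blast
    from openin_continuous_map_preimage[OF f_coord[OF i(2)], of "ball (f p \<alpha>) (inverse (Suc m))"]
    have "openin X (A i)" by (simp add: A_def i(1))
    moreover have "p \<in> A i" using p by (simp add: A_def i(1))
    ultimately show ?thesis unfolding filter_sets_nhdsin[OF p] by blast
  qed
  from A_filter_countable_refinement[OF F card_of_Field_omega1_times_nat A]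
  obtain G :: "nat \<Rightarrow> 'a set" where "(\<forall>n. G n \<in> filter_sets ?F) \<and>
      (\<forall>i\<in>Field omega1 \<times> UNIV. \<exists>n. G n \<subseteq> A i)" ..
  then have G: "\<And>n. G n \<in> filter_sets ?F"
      "\<And>i. i \<in> Field omega1 \<times> UNIV \<Longrightarrow> \<exists>n. G n \<subseteq> A i"
    by blast+
  \<comment> \<open>The sets \<open>s n\<close> are the complements of the points other than \<open>p\<close>, and \<open>?V\<close> when \<open>p\<close> is enumerated.\<close>
  define s where "s n = ?V - ({from_nat_into ?V n} - {p})" for n
  have s: "s n \<in> filter_sets ?F" for n
  proof -
    have "from_nat_into ?V n \<in> ?V"
      using p from_nat_into by (metis empty_iff)
    then have "closedin X ({from_nat_into ?V n} - {p})"
      using t1[unfolded t1_space_closedin_finite, rule_format, of "{from_nat_into ?V n} - {p}"]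
      by auto
    then have "openin X (s n)"
      unfolding s_def by (intro openin_diff) auto
    moreover have "p \<in> s n" using p by (auto simp: s_def)
    ultimately show ?thesis unfolding filter_sets_nhdsin[OF p] by blast
  qed
  define H where "H n = (\<Inter>i\<le>n. G i \<inter> s i)" for n
  have HF: "H n \<in> filter_sets ?F" for n
    using G(1) s unfolding H_def filter_sets_def
    by (simp add: eventually_ball_finite_distrib eventually_conj)
  have H1: "decseq H"
    unfolding decseq_def H_def by (intro allI impI INF_superset_mono) auto
  have H2: "p \<in> H n" for n
    using HF[of n] p by (auto simp: filter_sets_nhdsin)
  have H3: "H n \<subseteq> ?V" for n
    by (auto simp: H_def s_def)
  have H4: "\<exists>n. x \<notin> H n" if "x \<in> ?V" "x \<noteq> p" for x
  proof -
    obtain n where "from_nat_into ?V n = x"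
      using from_nat_into_surj[OF count \<open>x \<in> ?V\<close>] by blast
    then have "x \<notin> s n" using that by (simp add: s_def)
    then show ?thesis by (auto simp: H_def)
  qed
  from second_countable_coarsening[OF count p H1 H2 H3 H4]
  obtain Y where "topspace Y = ?V \<and>
      (\<forall>U. openin Y U \<longleftrightarrow> U \<subseteq> ?V \<and> (p \<in> U \<longrightarrow> (\<exists>n. H n \<subseteq> U))) \<and>
      second_countable Y \<and> tychonoff_space Y" ..
  then have Y: "topspace Y = ?V"
      "\<And>U. openin Y U \<longleftrightarrow> U \<subseteq> ?V \<and> (p \<in> U \<longrightarrow> (\<exists>n. H n \<subseteq> U))"
      "second_countable Y" "tychonoff_space Y"
    by simp_all
  have "continuous_map X Y id"
    unfolding continuous_map_def
  proof (intro conjI allI impI)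
    fix U assume U: "openin Y U"
    have "openin X U"
    proof (subst openin_subopen, intro ballI)
      fix x assume x: "x \<in> U"
      show "\<exists>T. openin X T \<and> x \<in> T \<and> T \<subseteq> U"
      proof (cases "x = p")
        case True
        then obtain n where "H n \<subseteq> U" using U x Y(2) by auto
        then show ?thesis using HF[of n] p True by (auto simp: filter_sets_nhdsin)
      next
        case False
        then show ?thesis using isolated[of x] U x Y(2) by blast
      qed
    qed
    moreover have "{x \<in> ?V. id x \<in> U} = U" using U Y(2) by auto
    ultimately show "openin X {x \<in> ?V. id x \<in> U}" by simp
  qed (simp add: Y(1))
  moreover have "continuous_map Y R_omega1 f"
    unfolding R_omega1_def continuous_map_componentwise
  proof (intro conjI ballI)
    show "f ` topspace Y \<subseteq> extensional (Field omega1)"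
      using f by (simp add: Y(1) R_omega1_def continuous_map_componentwise)
    fix \<alpha> assume \<alpha>: "\<alpha> \<in> Field omega1"
    show "continuous_map Y euclideanreal (\<lambda>x. f x \<alpha>)"
      unfolding continuous_map_def
    proof (intro conjI allI impI)
      fix W :: "real set" assume W: "openin euclideanreal W"
      have "\<exists>n. H n \<subseteq> {x \<in> ?V. f x \<alpha> \<in> W}" if pW: "f p \<alpha> \<in> W"
      proof -
        obtain e where e: "e > 0" "ball (f p \<alpha>) e \<subseteq> W"
          using W pW by (auto simp: open_contains_ball)
        obtain m where m: "inverse (Suc m) < e"
          using reals_Archimedean[OF e(1)] by auto
        obtain n where "G n \<subseteq> A (\<alpha>, m)"
          using G(2)[of "(\<alpha>, m)"] \<alpha> by auto
        then have "H n \<subseteq> A (\<alpha>, m)"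
          unfolding H_def by blast
        also have "\<dots> \<subseteq> {x \<in> ?V. f x \<alpha> \<in> W}"
          using m e(2) by (force simp: A_def)
        finally show ?thesis ..
      qed
      then show "openin Y {x \<in> topspace Y. f x \<alpha> \<in> W}"
        by (auto simp: Y)
    qed auto
  qed
  ultimately show "\<exists>(Y :: 'a topology) h g. tychonoff_space Y \<and> second_countable Y \<and>
      continuous_map X Y h \<and> continuous_map Y R_omega1 g \<and> (\<forall>x\<in>topspace X. f x = (g \<circ> h) x)"
    using Y(3,4) by (intro exI[of _ Y] exI[of _ id] exI[of _ f]) auto
qed

section \<open>The topology of the fan\<close>

text \<open>The index \<open>n\<close> stands for the point \<open>1 / (n + 1)\<close>, so that it ranges over all of \<open>\<omega>\<close>.\<close>

definition spike :: "nat \<Rightarrow> nat \<Rightarrow> (nat \<times> real) option" where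
  "spike k n = Some (k, 1 / real (Suc n))"

definition fan_nhd :: "(nat \<Rightarrow> nat) \<Rightarrow> (nat \<times> real) option set" where
  "fan_nhd g = insert fan_point {spike k n | k n. g k \<le> n}"

lemma spike_eq_iff [simp]: "spike k n = spike k' n' \<longleftrightarrow> k = k' \<and> n = n'"
  by (auto simp: spike_def)

lemma spike_neq_fan_point [simp]: "spike k n \<noteq> fan_point" "fan_point \<noteq> spike k n"
  by (auto simp: spike_def)

lemma spike_in_fan_nhd_iff [simp]: "spike k n \<in> fan_nhd g \<longleftrightarrow> g k \<le> n"
  by (auto simp: fan_nhd_def)

lemma fan_nhd_subset_iff: "fan_nhd f \<subseteq> fan_nhd g \<longleftrightarrow> (\<forall>k. g k \<le> f k)"
proof
  assume "fan_nhd f \<subseteq> fan_nhd g"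
  then have "spike k (f k) \<in> fan_nhd g" for k
    by (rule subsetD) simp
  then show "\<forall>k. g k \<le> f k" by simp
qed (auto simp: fan_nhd_def intro: order_trans)

lemma topspace_convergent_sequence:
  "topspace convergent_sequence = insert 0 (range (\<lambda>n. 1 / real (Suc n)))"
proof -
  have "(\<exists>n. x = 1 / real n \<and> n \<ge> 1) \<longleftrightarrow> (\<exists>n. x = 1 / real (Suc n))" for x
    by (metis One_nat_def Suc_le_D Suc_le_mono zero_le)
  then show ?thesis
    by (auto simp: convergent_sequence_def)
qed

lemma openin_convergent_sequence_trace:
  "openin convergent_sequence U \<longleftrightarrow> (\<exists>T. open T \<and> U = T \<inter> topspace convergent_sequence)"
  by (simp only: convergent_sequence_def openin_subtopology topspace_subtopology
      topspace_euclidean Int_UNIV_left open_openin[symmetric])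

lemma openin_convergent_sequence_singleton: "openin convergent_sequence {1 / real (Suc n)}"
proof -
  let ?C = "topspace convergent_sequence"
  \<comment> \<open>The only point \<open>1 / (m + 1)\<close> with \<open>1 / (n + 2) < 1 / (m + 1) < 1 / n\<close> is the one with \<open>m = n\<close>.
    In the form below, these inequalities make sense also for \<open>n = 0\<close>.\<close>
  let ?T = "{x :: real. 1 < x * real (n + 2) \<and> x * real n < 1}"
  have "y = 1 / real (Suc n)"
    if y: "1 < y * real (n + 2)" "y * real n < 1" "y \<in> ?C" for y
  proof -
    have "y \<noteq> 0" using y(1) by auto
    with y(3) obtain m where m: "y = 1 / real (Suc m)"
      unfolding topspace_convergent_sequence by blast
    have "real (Suc m) < real (n + 2)" "real n < real (Suc m)"
      using y(1,2) unfolding m by (simp_all add: field_simps)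
    then have "m = n" by linarith
    then show ?thesis using m by simp
  qed
  moreover have "1 / real (Suc n) \<in> ?T" by (simp add: divide_simps)
  moreover have "1 / real (Suc n) \<in> ?C" unfolding topspace_convergent_sequence by blast
  ultimately have "{1 / real (Suc n)} = ?T \<inter> ?C" by blast
  moreover have "open ?T"
    by (intro open_Collect_conj open_Collect_less continuous_intros)
  ultimately show ?thesis
    unfolding openin_convergent_sequence_trace by blast
qed

lemma openin_convergent_sequence:
  "openin convergent_sequence S \<longleftrightarrow> S \<subseteq> topspace convergent_sequence \<and>
     (0 \<in> S \<longrightarrow> (\<exists>N. \<forall>n\<ge>N. 1 / real (Suc n) \<in> S))"
    (is "_ \<longleftrightarrow> S \<subseteq> ?C \<and> (0 \<in> S \<longrightarrow> ?tail)")
proof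
  assume S: "openin convergent_sequence S"
  then obtain T where T: "open T" "S = T \<inter> ?C"
    unfolding openin_convergent_sequence_trace by blast
  have ?tail if "0 \<in> S"
  proof -
    have "0 \<in> T" using that T(2) by blast
    have "(\<lambda>n. 1 / real (Suc n)) \<longlonglongrightarrow> 0"
      by (rule LIMSEQ_Suc[OF lim_1_over_n])
    from topological_tendstoD[OF this T(1) \<open>0 \<in> T\<close>]
    obtain N where "\<forall>n\<ge>N. 1 / real (Suc n) \<in> T"
      unfolding eventually_sequentially ..
    then show ?thesis
      unfolding T(2) topspace_convergent_sequence by blast
  qed
  then show "S \<subseteq> ?C \<and> (0 \<in> S \<longrightarrow> ?tail)"
    using openin_subset[OF S] by blast
next
  assume S: "S \<subseteq> ?C \<and> (0 \<in> S \<longrightarrow> ?tail)"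
  show "openin convergent_sequence S"
  proof (subst openin_subopen, intro ballI)
    fix x assume "x \<in> S"
    show "\<exists>T. openin convergent_sequence T \<and> x \<in> T \<and> T \<subseteq> S"
    proof (cases "x = 0")
      case False
      then obtain n where "x = 1 / real (Suc n)"
        using S \<open>x \<in> S\<close> unfolding topspace_convergent_sequence by blast
      then have "openin convergent_sequence {x}"
        using openin_convergent_sequence_singleton by (simp only:)
      then show ?thesis using \<open>x \<in> S\<close> by blast
    next
      case True
      then obtain N where N: "\<And>n. n \<ge> N \<Longrightarrow> 1 / real (Suc n) \<in> S"
        using S \<open>x \<in> S\<close> by blast
      let ?T = "{..<1 / real (Suc N)} \<inter> ?C"
      have "openin convergent_sequence ?T"
        unfolding openin_convergent_sequence_trace using open_lessThan by blast
      moreover have "y \<in> S" if y: "y \<in> ?T" for y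
      proof (cases "y = 0")
        case True
        then show ?thesis using \<open>x = 0\<close> \<open>x \<in> S\<close> by simp
      next
        case False
        then obtain n where n: "y = 1 / real (Suc n)"
          using y unfolding topspace_convergent_sequence by blast
        then have "1 / real (Suc n) < 1 / real (Suc N)" using y by simp
        then have "N \<le> n" by (simp add: field_simps)
        then show ?thesis using N n by (simp only:)
      qed
      moreover have "x \<in> ?T" using True by (simp add: topspace_convergent_sequence)
      ultimately show ?thesis by blast
    qed
  qed
qed

lemma topspace_fan: "topspace fan = insert fan_point {spike k n | k n. True}"
  by (force simp: fan_def topspace_quotient_topology contract_limits_def spike_def
      topspace_convergent_sequence image_iff)

lemma openin_fan:
  "openin fan U \<longleftrightarrow> U \<subseteq> topspace fan \<and> (fan_point \<in> U \<longrightarrow> (\<exists>g. fan_nhd g \<subseteq> U))"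
proof -
  let ?C = "topspace convergent_sequence"
  have slice: "{x. (k, x) \<in> {z \<in> UNIV \<times> ?C. contract_limits z \<in> U}} =
      {x \<in> ?C. contract_limits (k, x) \<in> U}" for k
    by auto
  have contract: "contract_limits (k, 1 / real (Suc n)) = spike k n" for k n
    by (simp add: contract_limits_def spike_def)
  have seq_in: "1 / real (Suc n) \<in> ?C" "0 \<in> ?C" for n
    by (auto simp: topspace_convergent_sequence)
  have "openin fan U \<longleftrightarrow> U \<subseteq> topspace fan \<and>
      (\<forall>k. openin convergent_sequence {x \<in> ?C. contract_limits (k, x) \<in> U})"
    unfolding fan_def openin_quotient_topology openin_sum_topology topspace_quotient_topology
    by (auto simp: slice comp_def)
  also have "(\<forall>k. openin convergent_sequence {x \<in> ?C. contract_limits (k, x) \<in> U}) \<longleftrightarrow>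
      (\<forall>k. fan_point \<in> U \<longrightarrow> (\<exists>N. \<forall>n\<ge>N. spike k n \<in> U))"
    by (simp add: openin_convergent_sequence seq_in contract del: of_nat_Suc)
      (simp add: contract_limits_def)
  also have "\<dots> \<longleftrightarrow> (fan_point \<in> U \<longrightarrow> (\<exists>g. \<forall>k. \<forall>n\<ge>g k. spike k n \<in> U))"
    by metis
  also have "\<dots> \<longleftrightarrow> (fan_point \<in> U \<longrightarrow> (\<exists>g. fan_nhd g \<subseteq> U))"
    by (auto simp: fan_nhd_def subset_iff)
  finally show ?thesis .
qed

lemma openin_fan_nhd: "openin fan (fan_nhd g)"
proof -
  have "fan_nhd g \<subseteq> topspace fan" by (auto simp: fan_nhd_def topspace_fan)
  then show ?thesis unfolding openin_fan by blast
qed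

lemma filter_sets_nhdsin_fan:
  "A \<in> filter_sets (nhdsin fan fan_point) \<longleftrightarrow> (\<exists>g. fan_nhd g \<subseteq> A)"
proof -
  have O: "fan_point \<in> topspace fan" by (simp add: topspace_fan)
  have nhd: "openin fan (fan_nhd g)" "fan_point \<in> fan_nhd g" for g
    using openin_fan_nhd by (auto simp: fan_nhd_def)
  show ?thesis
    unfolding filter_sets_nhdsin[OF O] mem_Collect_eq
  proof
    assume "\<exists>U. openin fan U \<and> fan_point \<in> U \<and> U \<subseteq> A"
    then obtain U where U: "openin fan U" "fan_point \<in> U" "U \<subseteq> A" by blast
    then obtain g where "fan_nhd g \<subseteq> U" unfolding openin_fan by blast
    then show "\<exists>g. fan_nhd g \<subseteq> A" using U(3) by blast
  next
    assume "\<exists>g. fan_nhd g \<subseteq> A"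
    then show "\<exists>U. openin fan U \<and> fan_point \<in> U \<and> U \<subseteq> A" using nhd by blast
  qed
qed

lemma openin_fan_singleton: "x \<noteq> fan_point \<Longrightarrow> x \<in> topspace fan \<Longrightarrow> openin fan {x}"
  unfolding openin_fan by blast

lemma t1_space_fan: "t1_space fan"
  unfolding t1_space_def
proof (intro ballI impI)
  fix x y assume xy: "x \<in> topspace fan" "y \<in> topspace fan" "x \<noteq> y"
  show "\<exists>U. openin fan U \<and> x \<in> U \<and> y \<notin> U"
  proof (cases "x = fan_point")
    case True
    then obtain k n where y: "y = spike k n" using xy by (auto simp: topspace_fan)
    have "fan_point \<in> fan_nhd (\<lambda>_. Suc n)" by (simp add: fan_nhd_def)
    moreover have "y \<notin> fan_nhd (\<lambda>_. Suc n)" by (simp add: y)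
    ultimately show ?thesis using True openin_fan_nhd by blast
  next
    case False
    then show ?thesis using xy openin_fan_singleton by blast
  qed
qed

lemma countable_topspace_fan: "countable (topspace fan)"
proof -
  have "topspace fan = insert fan_point (range (\<lambda>(k, n). spike k n))"
    by (auto simp: topspace_fan)
  then show ?thesis by simp
qed

text \<open>
  Given countably many \<open>fan_nhd (g n)\<close>, a function that exceeds each \<open>g n\<close> at \<open>n\<close> describes a
  neighbourhood that contains none of them.
\<close>

lemma no_countable_base_fan: "\<not> (\<exists>\<B>. countable \<B> \<and> is_filter_base \<B> (nhdsin fan fan_point))"
proof
  assume "\<exists>\<B>. countable \<B> \<and> is_filter_base \<B> (nhdsin fan fan_point)"
  then obtain \<B> where \<B>: "countable \<B>" "\<B> \<subseteq> filter_sets (nhdsin fan fan_point)"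
      "\<And>A. A \<in> filter_sets (nhdsin fan fan_point) \<Longrightarrow> \<exists>B\<in>\<B>. B \<subseteq> A"
    by (auto simp: is_filter_base_def)
  have "UNIV \<in> filter_sets (nhdsin fan fan_point)" by (simp add: filter_sets_def)
  then have "\<B> \<noteq> {}" using \<B>(3) by blast
  have "\<exists>g. fan_nhd g \<subseteq> from_nat_into \<B> n" for n
    using from_nat_into[OF \<open>\<B> \<noteq> {}\<close>, of n] \<B>(2) filter_sets_nhdsin_fan by auto
  then have "\<forall>n. \<exists>g. fan_nhd g \<subseteq> from_nat_into \<B> n" ..
  from choice[OF this] obtain g where g: "\<forall>n. fan_nhd (g n) \<subseteq> from_nat_into \<B> n" ..
  let ?A = "fan_nhd (\<lambda>n. Suc (g n n))"
  have "?A \<in> filter_sets (nhdsin fan fan_point)"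
    unfolding filter_sets_nhdsin_fan by blast
  then obtain B where B: "B \<in> \<B>" "B \<subseteq> ?A" using \<B>(3) by blast
  from from_nat_into_surj[OF \<B>(1) B(1)] obtain n where "from_nat_into \<B> n = B" ..
  then have "fan_nhd (g n) \<subseteq> ?A" using g B(2) by (metis order_trans)
  then have "Suc (g n n) \<le> g n n" unfolding fan_nhd_subset_iff by (rule spec)
  then show False by simp
qed

lemma not_metrizable_fan: "\<not> metrizable_space fan"
proof
  assume "metrizable_space fan"
  then have "first_countable fan" by (rule metrizable_imp_first_countable)
  moreover have O: "fan_point \<in> topspace fan" by (simp add: topspace_fan)
  ultimately obtain \<B> where \<B>: "countable \<B>" "\<And>V. V \<in> \<B> \<Longrightarrow> openin fan V"
      "\<And>U. openin fan U \<Longrightarrow> fan_point \<in> U \<Longrightarrow> \<exists>V\<in>\<B>. fan_point \<in> V \<and> V \<subseteq> U"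
    unfolding first_countable_def by meson
  have "is_filter_base {V\<in>\<B>. fan_point \<in> V} (nhdsin fan fan_point)"
    unfolding is_filter_base_def filter_sets_nhdsin[OF O]
  proof (intro conjI subsetI ballI)
    fix V assume "V \<in> {V\<in>\<B>. fan_point \<in> V}"
    then show "V \<in> {A. \<exists>U. openin fan U \<and> fan_point \<in> U \<and> U \<subseteq> A}" using \<B>(2) by blast
  next
    fix A assume "A \<in> {A. \<exists>U. openin fan U \<and> fan_point \<in> U \<and> U \<subseteq> A}"
    then obtain U where "openin fan U" "fan_point \<in> U" "U \<subseteq> A" by blast
    then show "\<exists>B\<in>{V\<in>\<B>. fan_point \<in> V}. B \<subseteq> A" using \<B>(3)[of U] by blast
  qed
  moreover have "countable {V\<in>\<B>. fan_point \<in> V}" using \<B>(1) by simp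
  ultimately show False using no_countable_base_fan by blast
qed

section \<open>The equivalences\<close>

theorem A_filter_fan_iff: "A_filter (nhdsin fan fan_point) \<longleftrightarrow> omega1 <o bounding_number"
proof
  assume A: "A_filter (nhdsin fan fan_point)"
  show "omega1 <o bounding_number"
    unfolding omega1_less_bounding_number_iff
  proof (intro allI impI)
    fix B :: "(nat \<Rightarrow> nat) set" assume "|B| \<le>o omega1"
    moreover have "fan_nhd f \<in> filter_sets (nhdsin fan fan_point)" for f
      unfolding filter_sets_nhdsin_fan by blast
    ultimately have "\<exists>G :: nat \<Rightarrow> _. (\<forall>n. G n \<in> filter_sets (nhdsin fan fan_point)) \<and>
        (\<forall>f\<in>B. \<exists>n. G n \<subseteq> fan_nhd f)"
      by (intro A_filter_countable_refinement[OF A])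
    then obtain G :: "nat \<Rightarrow> (nat \<times> real) option set" where
        "(\<forall>n. G n \<in> filter_sets (nhdsin fan fan_point)) \<and> (\<forall>f\<in>B. \<exists>n. G n \<subseteq> fan_nhd f)" ..
    then have G: "\<And>n. G n \<in> filter_sets (nhdsin fan fan_point)"
        "\<And>f. f \<in> B \<Longrightarrow> \<exists>n. G n \<subseteq> fan_nhd f"
      by simp_all
    have "\<forall>n. \<exists>g. fan_nhd g \<subseteq> G n"
      using G(1) unfolding filter_sets_nhdsin_fan by (rule allI)
    from choice[OF this] obtain g where g: "\<forall>n. fan_nhd (g n) \<subseteq> G n" ..
    obtain u where u: "\<And>n. g n \<le>\<^sup>* u" using countable_family_bounded by blast
    have "f \<le>\<^sup>* u" if f: "f \<in> B" for f
    proof -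
      obtain n where "fan_nhd (g n) \<subseteq> fan_nhd f" using G(2)[OF f] g by blast
      then have "f \<le>\<^sup>* g n" by (intro le_star_if_le) (simp add: fan_nhd_subset_iff)
      then show ?thesis using u le_star_trans by blast
    qed
    then show "\<not> unbounded_family B" by (auto simp: unbounded_family_def)
  qed
next
  assume b: "omega1 <o bounding_number"
  show "A_filter (nhdsin fan fan_point)"
    unfolding A_filter_def
  proof (intro allI impI)
    fix A :: "nat set \<Rightarrow> (nat \<times> real) option set"
    assume "\<forall>\<alpha>\<in>Field omega1. A \<alpha> \<in> filter_sets (nhdsin fan fan_point)"
    from this[unfolded filter_sets_nhdsin_fan, THEN bchoice]
    obtain f where f: "\<forall>\<alpha>\<in>Field omega1. fan_nhd (f \<alpha>) \<subseteq> A \<alpha>" ..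
    have "|f ` Field omega1| \<le>o omega1"
      by (rule ordLeq_ordIso_trans[OF card_of_image card_of_Field_omega1])
    then have "\<not> unbounded_family (f ` Field omega1)"
      using b unfolding omega1_less_bounding_number_iff by (elim allE impE)
    then obtain u where u: "\<And>\<alpha>. \<alpha> \<in> Field omega1 \<Longrightarrow> f \<alpha> \<le>\<^sup>* u"
      unfolding unbounded_family_def by auto
    define G where "G n = fan_nhd (\<lambda>k. u k + n)" for n
    have "\<exists>n. G n \<subseteq> A \<alpha>" if \<alpha>: "\<alpha> \<in> Field omega1" for \<alpha>
    proof -
      obtain n where "\<And>k. f \<alpha> k \<le> u k + n"
        using le_star_imp_le_add_const[OF u[OF \<alpha>]] by blast
      then have "G n \<subseteq> fan_nhd (f \<alpha>)" by (simp add: G_def fan_nhd_subset_iff)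
      then show ?thesis using bspec[OF f \<alpha>] by blast
    qed
    moreover have "G n \<in> filter_sets (nhdsin fan fan_point)" for n
      unfolding filter_sets_nhdsin_fan G_def by blast
    ultimately show "\<exists>G :: nat \<Rightarrow> _. (\<forall>n. G n \<in> filter_sets (nhdsin fan fan_point)) \<and>
        (\<forall>\<alpha>\<in>Field omega1. \<exists>n. G n \<subseteq> A \<alpha>)"
      by (intro exI[of _ G]) blast
  qed
qed

lemma R_omega1_factorizable_fan_iff:
  "R_omega1_factorizable fan \<longleftrightarrow> A_filter (nhdsin fan fan_point)"
proof
  have "tychonoff_space fan"
    using openin_fan_singleton t1_space_fan
    by (intro tychonoff_if_one_nonisolated_point[where p = fan_point])
  then show "A_filter (nhdsin fan fan_point)" if "R_omega1_factorizable fan"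
    using that by (intro R_omega1_factorizable_imp_A_filter)
      (auto simp: tychonoff_space_def topspace_fan)
  show "R_omega1_factorizable fan" if "A_filter (nhdsin fan fan_point)"
    using that countable_topspace_fan openin_fan_singleton t1_space_fan
    by (intro A_filter_imp_R_omega1_factorizable) (auto simp: topspace_fan)
qed

theorem proposition4p4:
  shows "(omega1 <o bounding_number \<longleftrightarrow>
            A_filter (nhdsin fan fan_point) \<and>
            \<not> (\<exists>\<B>. countable \<B> \<and> is_filter_base \<B> (nhdsin fan fan_point))) \<and>
         (A_filter (nhdsin fan fan_point) \<and>
            \<not> (\<exists>\<B>. countable \<B> \<and> is_filter_base \<B> (nhdsin fan fan_point)) \<longleftrightarrow>
          \<not> metrizable_space fan \<and> R_omega1_factorizable fan)"
  using A_filter_fan_iff R_omega1_factorizable_fan_iff no_countable_base_fan not_metrizable_fan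
  by blast

end
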